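(* Let $\mathcal C$ be a closed convex subset (not necessarily bounded) of $\mathbb R^2$ with nonempty interior and let $O$ be a point outside $\mathcal C$. If the function $\tilde g(\varphi)$ has a local minimum at some $\varphi_*$ from the interior of its domain $D$ and $l(\varphi_* )\cap\mathcal C=[A^*B^*]$, $B^*\in[OA^*]$, then: (i) $\mathcal C$ has a unique supporting line $t_1$ at $A^*$ and a unique supporting line $t_2$ at $B^*$; i.e., $t_1$ is a tangent to $\partial\mathcal C$ at $A^*$ and $t_2$ is a tangent to $\partial\mathcal C$ at $B^*$. (ii) CPP holds for the lines $t_1,t_2,l(\varphi_* )$ and the points $A^*$, $B^*$ and $O$.
   Context: $l(\varphi)$ denotes the line through $O$ obtained by rotating a fixed line through $O$ by the angle $\varphi$ (in radians) around $O$. $D$ is the set of all $\varphi$ such that $l(\varphi)\cap\mathcal C$ is a nonempty (bounded) segment $[\tilde A(\varphi)\tilde B(\varphi)]$, with the end-points labelled so that $\tilde B(\varphi)\in[O\tilde A(\varphi)]$; $\tilde g:D\to\mathbb R$ is given by $\tilde g(\varphi)=|O\tilde A(\varphi)|-|O\tilde B(\varphi)|=|\tilde A(\varphi)\tilde B(\varphi)|$. A line $p$ is supporting for $\mathcal C$ at $A\in\mathcal C$ if $A\in p$ and $\mathcal C$ lies entirely in one of the two closed half-planes determined by $p$. A line $p$ is tangent to a curve $\gamma\subset\mathbb R^2$ at a point $P_0\in p\cap\gamma$ if there is an open disc $U$ centered at $P_0$ such that, in a rectangular coordinate system with $p$ as abscissa axis, $\gamma\cap U$ is the graph of a continuous real-valued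 function which is differentiable at $P_0$ with derivative zero there. (For a closed convex set with nonempty interior, $p$ is tangent to the boundary at $P_0$ if and only if $p$ is the only supporting line at $P_0$.) CPP (Concurrent Perpendiculars Property) for lines $l_1\ni A$, $l_2\ni B$, a line $l$ passing through $A,B,O$, and the points $A,B,O$: the perpendicular to $l_1$ at $A$, the perpendicular to $l_2$ at $B$ and the perpendicular to $l$ at $O$ have a common point. *)

theory Defs
  imports "HOL-Analysis.Analysis"
begin

type_synonym point = "real^2"

definition is_line :: "point set \<Rightarrow> bool" where
  "is_line p \<longleftrightarrow> affine p \<and> aff_dim p = 1"

definition rotate_about :: "point \<Rightarrow> real \<Rightarrow> point \<Rightarrow> point" where
  "rotate_about Q \<phi> x =
     Q + vector [cos \<phi> * (x - Q) $ 1 - sin \<phi> * (x - Q) $ 2,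
                 sin \<phi> * (x - Q) $ 1 + cos \<phi> * (x - Q) $ 2]"

text \<open>Throughout, \<open>Q\<close> is the centre of rotation (the point \<open>O\<close>) and
  \<open>l\<^sub>0\<close> the fixed line through it.\<close>

definition rotated_line :: "point \<Rightarrow> point set \<Rightarrow> real \<Rightarrow> point set" where
  "rotated_line Q l\<^sub>0 \<phi> = rotate_about Q \<phi> ` l\<^sub>0"

text \<open>A one-point intersection counts as a (degenerate) segment.\<close>

definition chord_domain :: "point \<Rightarrow> point set \<Rightarrow> point set \<Rightarrow> real set" where
  "chord_domain Q l\<^sub>0 C = {\<phi>. \<exists>A B. rotated_line Q l\<^sub>0 \<phi> \<inter> C = closed_segment A B}"

definition chord_endpoints ::
    "point \<Rightarrow> point set \<Rightarrow> point set \<Rightarrow> real \<Rightarrow> point \<Rightarrow> point \<Rightarrow> bool" where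
  "chord_endpoints Q l\<^sub>0 C \<phi> A B \<longleftrightarrow>
     rotated_line Q l\<^sub>0 \<phi> \<inter> C = closed_segment A B \<and> B \<in> closed_segment Q A"

text \<open>Only meaningful for \<open>\<phi>\<close> in \<open>chord_domain\<close>; there, if \<open>Q \<notin> C\<close>,
  suitable \<open>A\<close> and \<open>B\<close> exist and are unique.\<close>

definition chord_length :: "point \<Rightarrow> point set \<Rightarrow> point set \<Rightarrow> real \<Rightarrow> real" where
  "chord_length Q l\<^sub>0 C \<phi> =
     (let (A, B) = (SOME (A, B). chord_endpoints Q l\<^sub>0 C \<phi> A B) in dist Q A - dist Q B)"

definition supporting_line :: "point set \<Rightarrow> point \<Rightarrow> point set \<Rightarrow> bool" where
  "supporting_line C A p \<longleftrightarrow>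
     A \<in> C \<and> A \<in> p \<and> (\<exists>a b. a \<noteq> 0 \<and> p = {x. a \<bullet> x = b} \<and> C \<subseteq> {x. a \<bullet> x \<le> b})"

text \<open>The coordinate system has origin \<open>P\<close>, abscissa axis \<open>p\<close> with unit vector \<open>e\<close>, and
  ordinate unit vector \<open>n\<close>; the function is defined on an open interval around the
  abscissa \<open>0\<close> of \<open>P\<close>.\<close>

definition tangent_line :: "point set \<Rightarrow> point \<Rightarrow> point set \<Rightarrow> bool" where
  "tangent_line \<gamma> P p \<longleftrightarrow>
     P \<in> p \<inter> \<gamma> \<and>
     (\<exists>r e n a b f. r > 0 \<and> norm e = 1 \<and> norm n = 1 \<and> e \<bullet> n = 0 \<and>
        p = range (\<lambda>x. P + x *\<^sub>R e) \<and>
        a < 0 \<and> 0 < b \<and>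
        \<gamma> \<inter> ball P r = (\<lambda>x. P + x *\<^sub>R e + f x *\<^sub>R n) ` {a<..<b} \<and>
        continuous_on {a<..<b} f \<and> (f has_real_derivative 0) (at 0))"

definition perpendicular_at :: "point set \<Rightarrow> point \<Rightarrow> point set" where
  "perpendicular_at l A = {x. \<forall>y\<in>l. \<forall>z\<in>l. (x - A) \<bullet> (y - z) = 0}"

definition CPP ::
    "point set \<Rightarrow> point set \<Rightarrow> point set \<Rightarrow> point \<Rightarrow> point \<Rightarrow> point \<Rightarrow> bool" where
  "CPP l\<^sub>1 l\<^sub>2 l A B Q \<longleftrightarrow>
     is_line l\<^sub>1 \<and> A \<in> l\<^sub>1 \<and> is_line l\<^sub>2 \<and> B \<in> l\<^sub>2 \<and> is_line l \<and> A \<in> l \<and> B \<in> l \<and> Q \<in> l \<and>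
     perpendicular_at l\<^sub>1 A \<inter> perpendicular_at l\<^sub>2 B \<inter> perpendicular_at l Q \<noteq> {}"

lemma dist_of_mem_segment:
  fixes Q A B :: point
  assumes "B \<in> closed_segment Q A"
  shows "dist Q A - dist Q B = dist A B"
proof -
  have "dist Q A = dist Q B + dist B A"
    using assms between_mem_segment between by metis
  then show ?thesis by (simp add: dist_commute)
qed

lemma chord_length_eq:
  assumes "chord_endpoints Q l\<^sub>0 C \<phi> A B"
  shows "chord_length Q l\<^sub>0 C \<phi> = dist A B"
proof -
  define q where "q = (SOME (A, B). chord_endpoints Q l\<^sub>0 C \<phi> A B)"
  obtain A' B' where q: "q = (A', B')" by fastforce
  have "case q of (A, B) \<Rightarrow> chord_endpoints Q l\<^sub>0 C \<phi> A B"
    unfolding q_def by (rule someI[of _ "(A, B)"]) (use assms in simp)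
  then have e: "chord_endpoints Q l\<^sub>0 C \<phi> A' B'" by (simp add: q)
  have "closed_segment A B = closed_segment A' B'"
    using assms e by (simp add: chord_endpoints_def)
  then have "dist A B = dist A' B'"
    by (auto simp: closed_segment_eq doubleton_eq_iff dist_commute)
  moreover have "dist Q A' - dist Q B' = dist A' B'"
    using e by (intro dist_of_mem_segment) (simp add: chord_endpoints_def)
  ultimately show ?thesis
    by (simp add: chord_length_def q_def[symmetric] q)
qed

end

theory Submission
  imports Defs
begin

text \<open>
  Let \<open>u\<close> be the unit vector of the minimal chord, so that the end-points are \<open>Q + \<alpha> u\<close> and
  \<open>Q + \<beta> u\<close>, and let \<open>u + s u\<^sup>\<bottom>\<close>, \<open>u + t u\<^sup>\<bottom>\<close> be normals of supporting lines there; these lines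
  are transversal to the chord because all nearby lines through \<open>Q\<close> still meet \<open>C\<close>. The region
  between them bounds the chord in the direction at angle \<open>\<theta>\<close> by
  \<open>\<alpha> / (cos \<theta> + s sin \<theta>) - \<beta> / (cos \<theta> + t sin \<theta>)\<close>, with equality at \<open>\<theta> = 0\<close>. Hence this bound also
  has a local minimum at \<open>0\<close>, and its derivative there gives \<open>\<alpha> s = \<beta> t\<close>. As this holds for every
  pair of supporting lines, both are unique, and the three perpendiculars meet at
  \<open>Q - \<alpha> s u\<^sup>\<bottom> = Q - \<beta> t u\<^sup>\<bottom>\<close>.

  At a point with a unique supporting line every strictly inward direction enters the interior, so
  the boundary is locally the graph of a convex function squeezed between \<open>0\<close> and \<open>\<epsilon> \<bar>x\<bar>\<close>.
\<close>

section \<open>Rotations of the plane\<close>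

definition perp :: "point \<Rightarrow> point" where
  "perp v = vector [- v $ 2, v $ 1]"

text \<open>Rotation about the origin in the positive sense, written in the frame \<open>v\<close>,
  \<open>perp v\<close> instead of coordinates, so that its inner product with a fixed vector is at
  once a combination of \<open>cos \<theta>\<close> and \<open>sin \<theta>\<close>.\<close>

definition turn :: "real \<Rightarrow> point \<Rightarrow> point" where
  "turn \<theta> v = cos \<theta> *\<^sub>R v + sin \<theta> *\<^sub>R perp v"

lemma inner_perp [simp]: "v \<bullet> perp v = 0" "perp v \<bullet> v = 0"
  by (simp_all add: perp_def inner_vec_def sum_2)

lemma norm_perp [simp]: "norm (perp v) = norm v"
  by (simp add: perp_def norm_vec_def L2_set_def sum_2 add.commute)

lemma turn_turn: "turn a (turn b v) = turn (a + b) v"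
  by (simp add: turn_def perp_def vec_eq_iff forall_2 cos_add sin_add algebra_simps)

lemma turn_scaleR: "turn \<theta> (r *\<^sub>R v) = r *\<^sub>R turn \<theta> v"
  by (simp add: turn_def perp_def vec_eq_iff forall_2 algebra_simps)

lemma norm_turn [simp]: "norm (turn \<theta> v) = norm v"
proof -
  have "perp v \<bullet> perp v = v \<bullet> v"
    by (simp flip: power2_norm_eq_inner)
  then have "turn \<theta> v \<bullet> turn \<theta> v = (cos \<theta> * cos \<theta> + sin \<theta> * sin \<theta>) * (v \<bullet> v)"
    unfolding turn_def inner_add_left inner_add_right
    by (simp add: distrib_right del: sin_cos_squared_add3)
  then show ?thesis by (simp add: norm_eq_sqrt_inner)
qed

lemma rotate_about_turn: "rotate_about Q \<phi> x = Q + turn \<phi> (x - Q)"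
  by (simp add: rotate_about_def turn_def perp_def vec_eq_iff forall_2 right_diff_distrib)

lemma orthonormal_expansion:
  assumes "norm u = 1"
  shows "v = (v \<bullet> u) *\<^sub>R u + (v \<bullet> perp u) *\<^sub>R perp u"
proof -
  have "u $ 1 * u $ 1 + u $ 2 * u $ 2 = 1"
    using assms by (simp add: norm_eq_1 inner_vec_def sum_2)
  \<comment> \<open>The expansion is a polynomial identity up to the factor
    \<open>u $ 1 * u $ 1 + u $ 2 * u $ 2\<close>, which is 1 for a unit vector.\<close>
  then have "v $ 1 = v $ 1 * (u $ 1 * u $ 1 + u $ 2 * u $ 2)"
    "v $ 2 = v $ 2 * (u $ 1 * u $ 1 + u $ 2 * u $ 2)" by simp_all
  then show ?thesis
    by (simp add: perp_def vec_eq_iff forall_2 inner_vec_def sum_2 algebra_simps)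
qed

section \<open>Lines as hyperplanes and as parametrised ranges\<close>

lemma line_eq_hyperplane:
  assumes "norm u = 1"
  shows "range (\<lambda>t. Q + t *\<^sub>R u) = {x. perp u \<bullet> x = perp u \<bullet> Q}"
proof (intro set_eqI iffI)
  fix x assume "x \<in> {x. perp u \<bullet> x = perp u \<bullet> Q}"
  then have "(x - Q) \<bullet> perp u = 0" by (simp add: inner_diff inner_commute)
  then have "x = Q + ((x - Q) \<bullet> u) *\<^sub>R u"
    using orthonormal_expansion[OF assms, of "x - Q"] by (simp add: algebra_simps)
  then show "x \<in> range (\<lambda>t. Q + t *\<^sub>R u)" by blast
qed (auto simp: inner_add_right)

lemma is_line_hyperplane:
  fixes a :: point
  assumes "a \<noteq> 0"
  shows "is_line {x. a \<bullet> x = b}"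
  using assms by (simp add: is_line_def affine_hyperplane)

lemma is_lineE:
  assumes "is_line l" "Q \<in> l"
  obtains u where "norm u = 1" "l = range (\<lambda>t. Q + t *\<^sub>R u)"
proof -
  have l: "affine l" "aff_dim l = 1" using assms by (auto simp: is_line_def)
  have "l \<noteq> {Q}" using l by auto
  then obtain x where x: "x \<in> l" "x \<noteq> Q" using assms by blast
  have "affine hull {Q, x} = l"
  proof (rule affine_dim_equal)
    show "affine hull {Q, x} \<subseteq> l" using x assms l by (intro hull_minimal) auto
    show "aff_dim (affine hull {Q, x}) = aff_dim l" using x l by (simp add: aff_dim_2)
  qed (use l in auto)
  then have l2: "l = range (\<lambda>t. Q + t *\<^sub>R (x - Q))" by (simp add: affine_hull_2_alt)
  define u where "u = (1 / norm (x - Q)) *\<^sub>R (x - Q)"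
  have xQ: "x - Q = norm (x - Q) *\<^sub>R u" "norm u = 1" using x by (auto simp: u_def)
  have "range (\<lambda>t. Q + t *\<^sub>R (x - Q)) = range (\<lambda>t. Q + t *\<^sub>R u)"
  proof (intro set_eqI iffI)
    fix y assume "y \<in> range (\<lambda>t. Q + t *\<^sub>R (x - Q))"
    then obtain t where "y = Q + t *\<^sub>R (x - Q)" by blast
    then have "y = Q + (t * norm (x - Q)) *\<^sub>R u" by (subst (asm) xQ(1)) simp
    then show "y \<in> range (\<lambda>t. Q + t *\<^sub>R u)" by blast
  next
    fix y assume "y \<in> range (\<lambda>t. Q + t *\<^sub>R u)"
    then obtain t where "y = Q + (t / norm (x - Q)) *\<^sub>R (x - Q)" by (auto simp: u_def)
    then show "y \<in> range (\<lambda>t. Q + t *\<^sub>R (x - Q))" by blast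
  qed
  with l2 xQ that show ?thesis by metis
qed

lemma rotated_line_range:
  "rotated_line Q (range (\<lambda>t. Q + t *\<^sub>R u)) \<phi> = range (\<lambda>t. Q + t *\<^sub>R turn \<phi> u)"
  by (simp add: rotated_line_def image_image rotate_about_turn turn_scaleR)

section \<open>Unique supporting lines are tangents\<close>

text \<open>Two disjoint convex sets can be separated, and the bound on \<open>interior C\<close>
  passes to \<open>C\<close>, which is the closure of its interior. Below, \<open>S\<close> is an
  open ray, a single point or a whole line.\<close>

lemma separate_from_interior:
  fixes C S :: "point set"
  assumes "closed C" "convex C" "interior C \<noteq> {}" "convex S" "S \<noteq> {}" "S \<inter> interior C = {}"
  obtains c b where "c \<noteq> 0" "\<And>x. x \<in> C \<Longrightarrow> c \<bullet> x \<le> b" "\<And>x. x \<in> S \<Longrightarrow> b \<le> c \<bullet> x"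
proof -
  obtain c b where c: "c \<noteq> 0" "\<forall>x\<in>interior C. c \<bullet> x \<le> b" "\<forall>x\<in>S. b \<le> c \<bullet> x"
    using separating_hyperplane_sets[of "interior C" S] assms
    by (metis convex_interior inf_commute)
  have "closure (interior C) \<subseteq> {x. c \<bullet> x \<le> b}"
    using c by (intro closure_minimal closed_halfspace_le) auto
  moreover have "closure (interior C) = C"
    using assms by (simp add: convex_closure_interior)
  ultimately show ?thesis using c that by blast
qed

lemma supporting_line_not_interior:
  assumes "supporting_line C P p"
  shows "P \<notin> interior C"
proof
  assume P: "P \<in> interior C"
  obtain a b where a: "a \<noteq> 0" "p = {x. a \<bullet> x = b}" "C \<subseteq> {x. a \<bullet> x \<le> b}"
    using assms by (auto simp: supporting_line_def)
  have "interior C \<subseteq> {x. a \<bullet> x < b}"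
    using interior_mono[OF a(3)] a(1) by (simp add: interior_halfspace_le)
  with P show False using assms a by (auto simp: supporting_line_def)
qed

text \<open>Openness keeps \<open>Inf S\<close> and \<open>Sup S\<close> out of \<open>S\<close>,
  and convexity fills everything between them. This supplies the open interval that
  \<open>tangent_line\<close> demands as the domain of its function.\<close>

lemma open_convex_bounded_real:
  fixes S :: "real set"
  assumes "open S" "convex S" "bounded S" "x \<in> S"
  obtains a b where "a < x" "x < b" "S = {a<..<b}"
proof (rule that)
  have bdd: "bdd_above S" "bdd_below S"
    using assms bounded_imp_bdd_above bounded_imp_bdd_below by auto
  have ne: "S \<noteq> {}" using assms by auto
  have int: "y \<in> {Inf S<..<Sup S}" if y: "y \<in> S" for y
  proof -
    obtain e where e: "e > 0" "ball y e \<subseteq> S" using assms y open_contains_ball by blast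
    have "y + e/2 \<in> S" "y - e/2 \<in> S" using e by (auto simp: dist_norm subset_iff)
    then have "y + e/2 \<le> Sup S" "Inf S \<le> y - e/2"
      using bdd by (auto intro: cSup_upper cInf_lower)
    then show ?thesis using e by auto
  qed
  show "Inf S < x" "x < Sup S" using int[OF assms(4)] by auto
  show "S = {Inf S<..<Sup S}"
  proof (intro set_eqI iffI)
    fix y assume y: "y \<in> {Inf S<..<Sup S}"
    obtain p q where "p \<in> S" "p < y" "q \<in> S" "y < q"
      using y ne bdd by (metis cInf_less_iff greaterThanLessThan_iff less_cSup_iff)
    then show "y \<in> S"
      using assms(2) mem_is_interval_1_I[of S p q y] by (auto simp: is_interval_convex_1)
  qed (rule int)
qed

text \<open>A ray that never entered the interior could be separated from \<open>C\<close> by a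
  line. That line would support \<open>C\<close> at \<open>P\<close>, hence coincide with the given
  one, but its normal would then have to be both a nonnegative and a nonpositive multiple of
  \<open>n\<close>.\<close>

lemma unique_support_direction_interior:
  assumes C: "closed C" "convex C" "interior C \<noteq> {}" and "P \<in> C"
    and n: "n \<noteq> 0" "\<And>x. x \<in> C \<Longrightarrow> 0 \<le> n \<bullet> (x - P)"
    and unique: "\<And>p. supporting_line C P p \<Longrightarrow> p = {x. n \<bullet> (x - P) = 0}"
    and d: "0 < n \<bullet> d"
  shows "\<exists>y>0. P + y *\<^sub>R d \<in> interior C"
proof (rule ccontr)
  assume neg: "\<not> ?thesis"
  then have out: "P + y *\<^sub>R d \<notin> interior C" if "0 < y" for y
    using that neg by blast
  let ?S = "(\<lambda>y. P + y *\<^sub>R d) ` {0<..}"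
  have cS: "convex ?S"
  proof -
    have "?S = (+) P ` (\<lambda>y. y *\<^sub>R d) ` {0<..}" by (simp add: image_image)
    then show ?thesis
      by (simp only:) (intro convex_translation convex_linear_image linear_scaleR_left convex_real_interval)
  qed
  obtain c b where c: "c \<noteq> 0" "\<And>x. x \<in> C \<Longrightarrow> c \<bullet> x \<le> b" "\<And>x. x \<in> ?S \<Longrightarrow> b \<le> c \<bullet> x"
    by (rule separate_from_interior[OF C cS]) (use out in auto)
  have ineq: "b - c \<bullet> P \<le> y * (c \<bullet> d)" if "0 < y" for y
    using c(3)[OF imageI[of y]] that by (simp add: inner_add_right)
  \<comment> \<open>Letting \<open>y\<close> tend to 0 in \<open>ineq\<close> gives
    \<open>b \<le> c \<bullet> P\<close>, so the separating line passes through
    \<open>P\<close>.\<close>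
  have "((\<lambda>y. y * (c \<bullet> d)) \<longlongrightarrow> 0 * (c \<bullet> d)) (at_right 0)" by (intro tendsto_intros)
  moreover have "\<forall>\<^sub>F y in at_right 0. b - c \<bullet> P \<le> y * (c \<bullet> d)"
    using ineq by (auto simp: eventually_at_filter)
  ultimately have "b - c \<bullet> P \<le> 0 * (c \<bullet> d)"
    by (rule tendsto_lowerbound) simp
  then have b: "b = c \<bullet> P" using c(2)[OF \<open>P \<in> C\<close>] by simp
  have cd: "0 \<le> c \<bullet> d" using ineq[of 1] b by simp
  have "supporting_line C P {x. c \<bullet> x = b}"
    using c b \<open>P \<in> C\<close> by (auto simp: supporting_line_def)
  then have eq: "{x. c \<bullet> x = b} = {x. n \<bullet> (x - P) = 0}" by (rule unique)
  define k where "k = (c \<bullet> d) / (n \<bullet> d)"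
  have k: "k \<ge> 0" using cd d by (simp add: k_def)
  have c_n: "c \<bullet> v = k * (n \<bullet> v)" for v
  proof -
    \<comment> \<open>Subtracting a multiple of \<open>d\<close> from \<open>v\<close> leaves a
      vector along the common line. There \<open>c\<close> vanishes too, so \<open>c\<close> is
      determined by its value on \<open>d\<close>.\<close>
    define z where "z = v - ((n \<bullet> v) / (n \<bullet> d)) *\<^sub>R d"
    have "P + z \<in> {x. n \<bullet> (x - P) = 0}" using d by (simp add: z_def inner_diff_right inner_add_right)
    then have "c \<bullet> (P + z) = b" using eq by blast
    then have "c \<bullet> z = 0" using b by (simp add: inner_add_right)
    then show ?thesis by (simp add: z_def inner_diff_right k_def)
  qed
  \<comment> \<open>At an interior point \<open>n\<close> is strictly positive while
    \<open>c\<close> is nonpositive, which forces \<open>k \<le> 0\<close>.\<close>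
  obtain x where x: "x \<in> interior C" using C by blast
  have "interior C \<subseteq> interior {x. n \<bullet> x \<ge> n \<bullet> P}"
    using n(2) by (intro interior_mono) (auto simp: inner_diff_right)
  then have "n \<bullet> (x - P) > 0" using x n(1) by (auto simp: interior_halfspace_ge inner_diff_right)
  moreover have "c \<bullet> (x - P) \<le> 0"
    using c(2)[of x] x interior_subset b by (auto simp: inner_diff_right)
  ultimately have "k \<le> 0" using c_n[of "x - P"] by (simp add: mult_le_0_iff)
  then have "k = 0" using k by simp
  then have "c \<bullet> c = 0" using c_n[of c] by simp
  then show False using c(1) by simp
qed


lemma toward_interior:
  fixes C :: "point set"
  assumes "convex C" "P \<in> C" "P + y *\<^sub>R d \<in> interior C" "0 < z" "z \<le> y"
  shows "P + z *\<^sub>R d \<in> interior C"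
proof -
  have "P - (z / y) *\<^sub>R (P - (P + y *\<^sub>R d)) \<in> interior C"
    using assms by (intro mem_interior_convex_shrink) auto
  then show ?thesis using assms by simp
qed

text \<open>In coordinates with the inward normal \<open>n\<close> as ordinate direction, the
  boundary near \<open>P\<close> is the graph of the lowest height \<open>f\<close> of
  \<open>C\<close>. Convexity of \<open>C\<close> makes \<open>f\<close> convex, hence continuous,
  and the inward directions of small slope bound its difference quotients at 0.\<close>

lemma unique_support_tangent:
  assumes C: "closed C" "convex C" "interior C \<noteq> {}"
    and t: "supporting_line C P t"
    and unique: "\<And>p. supporting_line C P p \<Longrightarrow> p = t"
  shows "tangent_line (frontier C) P t"
proof -
  obtain c b where c: "c \<noteq> 0" "t = {x. c \<bullet> x = b}" "C \<subseteq> {x. c \<bullet> x \<le> b}"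
    and P: "P \<in> C" "c \<bullet> P = b"
    using t by (auto simp: supporting_line_def)
  \<comment> \<open>The minus sign turns the outer normal \<open>c\<close> inward; \<open>e\<close>
    is chosen so that \<open>perp e = n\<close>, which lets \<open>orthonormal_expansion\<close> for
    \<open>e\<close> yield the coordinates of \<open>pt\<close>.\<close>
  define n where "n = (- 1 / norm c) *\<^sub>R c"
  define e where "e = - perp n"
  have nn: "norm n = 1" using c by (simp add: n_def)
  have ne: "norm e = 1" using nn by (simp add: e_def)
  have pe: "perp e = n" by (simp add: e_def perp_def vec_eq_iff forall_2)
  have en: "e \<bullet> n = 0" "n \<bullet> e = 0" using pe inner_perp by metis+
  have nn1: "n \<bullet> n = 1" "e \<bullet> e = 1" using nn ne by (simp_all add: norm_eq_1)
  have n_c: "n \<bullet> (x - P) = (b - c \<bullet> x) / norm c" for x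
    using P by (simp add: n_def inner_diff_right diff_divide_distrib)
  have nC: "0 \<le> n \<bullet> (x - P)" if "x \<in> C" for x
    using that c by (auto simp: n_c)
  have t_eq: "t = {x. n \<bullet> (x - P) = 0}" using c by (auto simp: n_c)
  have t_range: "t = range (\<lambda>x. P + x *\<^sub>R e)"
    using line_eq_hyperplane[OF ne, of P] by (auto simp: t_eq pe inner_diff_right)
  define pt where "pt x y = P + x *\<^sub>R e + y *\<^sub>R n" for x y
  have pt_surj: "z = pt ((z - P) \<bullet> e) ((z - P) \<bullet> n)" for z
    using orthonormal_expansion[OF ne, of "z - P"] by (simp add: pt_def pe algebra_simps)
  have pt_comb: "(1 - u) *\<^sub>R pt x y + u *\<^sub>R pt x' y' = pt ((1 - u) * x + u * x') ((1 - u) * y + u * y')"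
    for u x y x' y' by (simp add: pt_def algebra_simps)
  have pt_n: "n \<bullet> (pt x y - P) = y" for x y
    by (simp add: pt_def inner_add_right inner_diff_right en nn1)
  have pt_ball: "pt x y \<in> ball P h \<longleftrightarrow> x\<^sup>2 + y\<^sup>2 < h\<^sup>2" if "h > 0" for x y h
  proof -
    have "(dist P (pt x y))\<^sup>2 = x\<^sup>2 + y\<^sup>2"
      unfolding dist_norm norm_minus_commute[of P] power2_norm_eq_inner
      by (simp add: pt_def inner_add_left inner_add_right en nn1 power2_eq_square)
    then show ?thesis using that power_mono_iff[of h "dist P (pt x y)" 2]
      by (simp add: not_le[symmetric])
  qed
  have inward: "\<exists>y>0. P + y *\<^sub>R d \<in> interior C" if "0 < n \<bullet> d" for d
    by (rule unique_support_direction_interior[OF C P(1) _ nC _ that])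
      (use nn unique t_eq in auto)
  \<comment> \<open>The two directions of slope \<open>\<epsilon>\<close> on either side of the
    normal both enter the interior, and the segments from \<open>P\<close> to the points reached
    stay inside it.\<close>
  have cone: "\<exists>\<delta>>0. \<forall>x. 0 < \<bar>x\<bar> \<and> \<bar>x\<bar> \<le> \<delta> \<longrightarrow> pt x (\<epsilon> * \<bar>x\<bar>) \<in> interior C" if \<epsilon>: "\<epsilon> > 0" for \<epsilon>
  proof -
    obtain y1 where y1: "y1 > 0" "P + y1 *\<^sub>R (e + \<epsilon> *\<^sub>R n) \<in> interior C"
      using inward[of "e + \<epsilon> *\<^sub>R n"] \<epsilon> by (auto simp: inner_add_right en nn1)
    obtain y2 where y2: "y2 > 0" "P + y2 *\<^sub>R (- e + \<epsilon> *\<^sub>R n) \<in> interior C"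
      using inward[of "- e + \<epsilon> *\<^sub>R n"] \<epsilon> by (auto simp: inner_add_right inner_diff_right en nn1)
    have "pt x (\<epsilon> * \<bar>x\<bar>) \<in> interior C" if "0 < \<bar>x\<bar>" "\<bar>x\<bar> \<le> min y1 y2" for x
    proof (cases "x > 0")
      case True
      then show ?thesis
        using toward_interior[OF C(2) P(1) y1(2), of x] that
        by (simp add: pt_def algebra_simps)
    next
      case False
      then show ?thesis
        using toward_interior[OF C(2) P(1) y2(2), of "- x"] that
        by (simp add: pt_def algebra_simps)
    qed
    then show ?thesis using y1 y2 by (intro exI[of _ "min y1 y2"]) auto
  qed
  \<comment> \<open>Slope 1 makes the corners \<open>pt (- h) h\<close> and \<open>pt h h\<close>
    interior points, hence also the whole segment between them. This \<open>h\<close> becomes the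
    radius of the disc.\<close>
  obtain h where h: "h > 0" "\<forall>x. 0 < \<bar>x\<bar> \<and> \<bar>x\<bar> \<le> h \<longrightarrow> pt x \<bar>x\<bar> \<in> interior C"
    using cone[of 1] by auto
  have top: "pt x h \<in> interior C" if "\<bar>x\<bar> \<le> h" for x
  proof -
    define u where "u = (x + h) / (2 * h)"
    have u: "0 \<le> u" "u \<le> 1" "(1 - u) * (- h) + u * h = x"
      using that h(1) by (auto simp: u_def field_simps)
    have "pt (- h) h \<in> interior C" "pt h h \<in> interior C"
      using h(2)[rule_format, of h] h(2)[rule_format, of "- h"] h(1) by auto
    then have "(1 - u) *\<^sub>R pt (- h) h + u *\<^sub>R pt h h \<in> interior C"
      using u C by (intro convexD_alt) auto
    then show ?thesis unfolding pt_comb u(3) by (simp add: algebra_simps)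
  qed
  \<comment> \<open>The heights over \<open>x\<close> are bounded below by 0 because of
    \<open>nC\<close>. For \<open>\<bar>x\<bar> \<le> h\<close> they form a closed set containing
    \<open>h\<close>, so the infimum is attained.\<close>
  define f where "f x = Inf {y. pt x y \<in> C}" for x
  have bdd: "bdd_below {y. pt x y \<in> C}" for x
    using nC pt_n by (intro bdd_belowI[of _ 0]) fastforce
  have f_le: "f x \<le> y" if "pt x y \<in> C" for x y
    unfolding f_def using bdd that by (intro cInf_lower) auto
  have f_in: "pt x (f x) \<in> C" if "\<bar>x\<bar> \<le> h" for x
  proof -
    have "closed ((\<lambda>y. pt x y) -` C)"
      unfolding pt_def using C by (intro closed_vimage continuous_intros)
    moreover have "h \<in> {y. pt x y \<in> C}" using top[OF that] interior_subset by blast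
    ultimately have "f x \<in> {y. pt x y \<in> C}"
      unfolding f_def using bdd by (intro closed_contains_Inf) (auto simp: vimage_def)
    then show ?thesis by simp
  qed
  have f_nonneg: "0 \<le> f x" if "\<bar>x\<bar> \<le> h" for x
    using nC[OF f_in[OF that]] by (simp add: pt_n)
  have f0: "f 0 = 0"
    using f_le[of 0 0] f_nonneg[of 0] h P by (simp add: pt_def)
  have f_comb: "f ((1 - u) * x + u * y) \<le> (1 - u) * f x + u * f y"
    if "\<bar>x\<bar> \<le> h" "\<bar>y\<bar> \<le> h" "0 \<le> u" "u \<le> 1" for x y u
    using convexD_alt[OF C(2) f_in f_in, of x y u] that by (intro f_le) (simp add: pt_comb)
  have cont: "continuous_on {-h<..<h} f"
    using f_comb by (intro convex_on_continuous convex_onI) auto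
  have deriv: "(f has_real_derivative 0) (at 0)"
    unfolding DERIV_def
  proof (rule LIM_I)
    fix \<epsilon> :: real assume \<epsilon>: "\<epsilon> > 0"
    \<comment> \<open>Half of \<open>\<epsilon>\<close> turns the weak bound on \<open>f x\<close>
      into the strict one required by the limit.\<close>
    obtain \<delta> where \<delta>: "\<delta> > 0" "\<forall>x. 0 < \<bar>x\<bar> \<and> \<bar>x\<bar> \<le> \<delta> \<longrightarrow> pt x (\<epsilon>/2 * \<bar>x\<bar>) \<in> interior C"
      using cone[of "\<epsilon>/2"] \<epsilon> by auto
    have "norm ((f (0 + x) - f 0) / x - 0) < \<epsilon>" if x: "x \<noteq> 0" "norm (x - 0) < min \<delta> h" for x
    proof -
      have "pt x (\<epsilon>/2 * \<bar>x\<bar>) \<in> C" using \<delta>(2)[rule_format, of x] x interior_subset[of C] by auto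
      then have "f x \<le> \<epsilon>/2 * \<bar>x\<bar>" by (rule f_le)
      moreover have "\<epsilon>/2 * \<bar>x\<bar> < \<epsilon> * \<bar>x\<bar>" using \<epsilon> x by simp
      moreover have "0 \<le> f x" using x by (intro f_nonneg) auto
      ultimately show ?thesis using x f0 by (simp add: divide_less_eq)
    qed
    then show "\<exists>s>0. \<forall>x. x \<noteq> 0 \<and> norm (x - 0) < s \<longrightarrow> norm ((f (0 + x) - f 0) / x - 0) < \<epsilon>"
      using \<delta> h by (intro exI[of _ "min \<delta> h"]) auto
  qed
  \<comment> \<open>The abscissae whose graph points lie in the disc. To be an interval,
    \<open>S\<close> must be convex: a convex combination of two graph points stays in the disc, and
    lowering it to the graph keeps it there because \<open>f\<close> is nonnegative.\<close>
  define S where "S = {x \<in> {-h<..<h}. x\<^sup>2 + (f x)\<^sup>2 < h\<^sup>2}"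
  have "open S"
  proof -
    have "open ({-h<..<h} \<inter> (\<lambda>x. x\<^sup>2 + (f x)\<^sup>2) -` {..<h\<^sup>2})"
      using cont by (intro continuous_open_preimage continuous_intros) auto
    moreover have "S = {-h<..<h} \<inter> (\<lambda>x. x\<^sup>2 + (f x)\<^sup>2) -` {..<h\<^sup>2}" by (auto simp: S_def)
    ultimately show ?thesis by simp
  qed
  moreover have "convex S"
    unfolding convex_alt
  proof (intro ballI allI impI, elim conjE)
    fix x y u :: real assume xy: "x \<in> S" "y \<in> S" and u: "0 \<le> u" "u \<le> 1"
    let ?z = "(1 - u) * x + u * y"
    have "pt x (f x) \<in> ball P h" "pt y (f y) \<in> ball P h"
      using xy by (auto simp: S_def pt_ball[OF h(1)] simp del: mem_ball)
    then have "(1 - u) *\<^sub>R pt x (f x) + u *\<^sub>R pt y (f y) \<in> ball P h"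
      using u by (intro convexD_alt convex_ball)
    then have sq: "?z\<^sup>2 + ((1 - u) * f x + u * f y)\<^sup>2 < h\<^sup>2"
      by (simp add: pt_comb pt_ball[OF h(1)] del: mem_ball)
    have z: "?z \<in> {-h<..<h}"
      using convexD_alt[of "{-h<..<h}" x y u] xy u by (auto simp: S_def)
    have "(f ?z)\<^sup>2 \<le> ((1 - u) * f x + u * f y)\<^sup>2"
    proof (rule power_mono)
      show "f ?z \<le> (1 - u) * f x + u * f y" using xy u by (intro f_comb) (auto simp: S_def)
      show "0 \<le> f ?z" using z by (intro f_nonneg) (simp add: abs_le_iff)
    qed
    then show "(1 - u) *\<^sub>R x + u *\<^sub>R y \<in> S" using sq z by (simp add: S_def)
  qed
  moreover have "bounded S"
    by (rule bounded_subset[of "{-h<..<h}"]) (auto simp: S_def)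
  moreover have "0 \<in> S" using h f0 by (simp add: S_def)
  ultimately obtain a' b' where ab: "a' < 0" "0 < b'" "S = {a'<..<b'}"
    by (rule open_convex_bounded_real)
  have front: "frontier C = C - interior C" using C by (simp add: frontier_def)
  have graph: "frontier C \<inter> ball P h = (\<lambda>x. pt x (f x)) ` S"
  proof (intro set_eqI iffI)
    fix z assume z: "z \<in> frontier C \<inter> ball P h"
    obtain x y where xy: "z = pt x y" using pt_surj by blast
    have sq: "x\<^sup>2 + y\<^sup>2 < h\<^sup>2" using z xy pt_ball[OF h(1)] by blast
    then have "x\<^sup>2 < h\<^sup>2" "y\<^sup>2 < h\<^sup>2"
      by (smt (verit) zero_le_power2)+
    then have xh: "\<bar>x\<bar> < h" "\<bar>y\<bar> < h" using h(1) abs_le_square_iff[of h x] abs_le_square_iff[of h y] by auto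
    have "f x \<le> y" using z xy front by (intro f_le) auto
    \<comment> \<open>A point above the graph lies on the vertical segment from the graph point to
      the interior point \<open>pt x h\<close>, hence is itself interior.\<close>
    moreover have False if "f x < y"
    proof -
      have "pt x (f x) + (h - f x) *\<^sub>R n \<in> interior C"
        using top[of x] xh by (simp add: pt_def algebra_simps)
      then have "pt x (f x) + (y - f x) *\<^sub>R n \<in> interior C"
        by (rule toward_interior[OF C(2) f_in[OF less_imp_le[OF xh(1)]]]) (use that xh in auto)
      then have "z \<in> interior C" by (simp add: xy pt_def algebra_simps)
      then show False using z front by auto
    qed
    ultimately have "y = f x" by fastforce
    then show "z \<in> (\<lambda>x. pt x (f x)) ` S" using xy sq xh by (auto simp: S_def abs_less_iff)
  next
    fix z assume "z \<in> (\<lambda>x. pt x (f x)) ` S"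
    then obtain x where x: "z = pt x (f x)" "x \<in> S" by blast
    have "z \<notin> interior C"
    proof
      assume "z \<in> interior C"
      then obtain \<delta> where \<delta>: "\<delta> > 0" "ball z \<delta> \<subseteq> C" using mem_interior by blast
      \<comment> \<open>A point of \<open>C\<close> just below the graph contradicts the minimality
        of \<open>f x\<close>.\<close>
      have "pt x (f x - \<delta>/2) \<in> ball z \<delta>"
        using \<delta> nn by (simp add: x pt_def dist_norm algebra_simps)
      then show False using f_le[of x "f x - \<delta>/2"] \<delta> by auto
    qed
    then show "z \<in> frontier C \<inter> ball P h"
      using f_in[of x] x pt_ball[OF h(1)] by (auto simp: front S_def simp del: mem_ball)
  qed
  have "P \<in> frontier C" using P supporting_line_not_interior[OF t] front by simp
  moreover have "P \<in> t" using t by (simp add: supporting_line_def)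
  moreover have "continuous_on {a'<..<b'} f"
    using cont by (rule continuous_on_subset) (auto simp: S_def simp flip: ab(3))
  moreover have "frontier C \<inter> ball P h = (\<lambda>x. P + x *\<^sub>R e + f x *\<^sub>R n) ` {a'<..<b'}"
    using graph ab(3) by (simp add: pt_def)
  ultimately show ?thesis
    unfolding tangent_line_def using h(1) ne nn en(1) t_range ab(1,2) deriv
    by (intro conjI exI[of _ h] exI[of _ e] exI[of _ n] exI[of _ a'] exI[of _ b'] exI[of _ f]) auto
qed

section \<open>Minimal chords\<close>

text \<open>\<open>nearby\<close> keeps from the local minimum only what is used: two points of
  \<open>C\<close> on each neighbouring line, the first at positive parameter, with parameters
  differing by at least the minimal length.\<close>

locale minimal_chord =
  fixes C :: "point set" and Q u :: point and \<alpha> \<beta> :: real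
  assumes C: "closed C" "convex C" "interior C \<noteq> {}"
    and u: "norm u = 1"
    and \<beta>: "0 < \<beta>" and \<beta>\<alpha>: "\<beta> \<le> \<alpha>"
    and chord: "\<And>t. Q + t *\<^sub>R u \<in> C \<longleftrightarrow> \<beta> \<le> t \<and> t \<le> \<alpha>"
    and nearby: "\<forall>\<^sub>F \<theta> in nhds 0. \<exists>\<sigma> \<rho>. 0 < \<sigma> \<and> Q + \<sigma> *\<^sub>R turn \<theta> u \<in> C \<and>
      Q + \<rho> *\<^sub>R turn \<theta> u \<in> C \<and> \<alpha> - \<beta> \<le> \<rho> - \<sigma>"
begin

text \<open>The normal is scaled to have component 1 along \<open>u\<close>, so a line transversal
  to the chord is encoded by the single number \<open>s\<close>.\<close>

definition slanted_line :: "real \<Rightarrow> point \<Rightarrow> point set" where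
  "slanted_line s P = {x. (u + s *\<^sub>R perp u) \<bullet> (x - P) = 0}"

lemma inner_u [simp]: "u \<bullet> u = 1" "perp u \<bullet> perp u = 1"
  using u by (simp_all flip: norm_eq_1)

lemma endpoints_in: "Q + \<alpha> *\<^sub>R u \<in> C" "Q + \<beta> *\<^sub>R u \<in> C"
  using chord \<beta>\<alpha> by auto

text \<open>Otherwise \<open>C\<close> would lie on one side of the chord line through
  \<open>Q\<close>, while a small turn of \<open>u\<close> towards the other side still gives a ray
  that meets \<open>C\<close>.\<close>

lemma support_transversal:
  assumes "a \<noteq> 0" "\<And>x. x \<in> C \<Longrightarrow> a \<bullet> (x - Q) \<le> 0"
  shows "a \<bullet> u \<noteq> 0"
proof
  assume au: "a \<bullet> u = 0"
  define k where "k = a \<bullet> perp u"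
  have "k \<noteq> 0" using orthonormal_expansion[OF u, of a] au assms(1) by (auto simp: k_def)
  obtain d where d: "d > 0" "\<And>\<theta>. \<bar>\<theta>\<bar> < d \<Longrightarrow> \<exists>\<sigma>>0. Q + \<sigma> *\<^sub>R turn \<theta> u \<in> C"
    using nearby by (auto simp: eventually_nhds_metric dist_norm) blast
  \<comment> \<open>The sign selects the forbidden side; the bound 1 keeps the angle below \<pi>,
    where \<open>sin\<close> is positive.\<close>
  define \<theta> where "\<theta> = sgn k * min (d / 2) 1"
  have "\<bar>\<theta>\<bar> < d" using d(1) by (auto simp: \<theta>_def abs_mult sgn_if)
  then obtain \<sigma> where \<sigma>: "\<sigma> > 0" "Q + \<sigma> *\<^sub>R turn \<theta> u \<in> C" using d(2) by blast
  have "sin (min (d/2) 1) > 0" using d(1) pi_gt3 by (intro sin_gt_zero) auto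
  then have "k * sin \<theta> > 0" using \<open>k \<noteq> 0\<close> by (auto simp: \<theta>_def sgn_if mult_neg_pos)
  then have "a \<bullet> (Q + \<sigma> *\<^sub>R turn \<theta> u - Q) > 0"
    using \<sigma>(1) au by (simp add: turn_def inner_add_right k_def mult.commute)
  with assms(2)[OF \<sigma>(2)] show False by simp
qed

lemma not_interior_endpoint:
  assumes "t = \<alpha> \<or> t = \<beta>"
  shows "Q + t *\<^sub>R u \<notin> interior C"
proof
  assume "Q + t *\<^sub>R u \<in> interior C"
  then obtain d where d: "d > 0" "ball (Q + t *\<^sub>R u) d \<subseteq> C" using mem_interior by blast
  have "Q + (t + d/2) *\<^sub>R u \<in> ball (Q + t *\<^sub>R u) d" "Q + (t - d/2) *\<^sub>R u \<in> ball (Q + t *\<^sub>R u) d"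
    using d u by (simp_all add: dist_norm algebra_simps)
  then show False using d chord assms \<beta>\<alpha> by fastforce
qed

text \<open>If the chord were a single point, its line would miss the interior and could be
  separated from \<open>C\<close>. A functional bounded below on a line is constant along it, which
  contradicts \<open>support_transversal\<close>.\<close>

lemma nondegenerate: "\<beta> < \<alpha>"
proof (rule ccontr)
  assume "\<not> \<beta> < \<alpha>"
  then have eq: "\<beta> = \<alpha>" using \<beta>\<alpha> by simp
  let ?l = "{x. perp u \<bullet> x = perp u \<bullet> Q}"
  have l: "?l = range (\<lambda>t. Q + t *\<^sub>R u)" using line_eq_hyperplane[OF u] by simp
  have "?l \<noteq> {}" by auto
  moreover have "?l \<inter> interior C = {}"
    unfolding l using not_interior_endpoint chord interior_subset eq by fastforce
  ultimately obtain c b where c: "c \<noteq> 0" "\<And>x. x \<in> C \<Longrightarrow> c \<bullet> x \<le> b" "\<And>x. x \<in> ?l \<Longrightarrow> b \<le> c \<bullet> x"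
    using separate_from_interior[OF C convex_hyperplane[of "perp u" "perp u \<bullet> Q"]] by blast
  have ge: "b \<le> c \<bullet> Q + t * (c \<bullet> u)" for t
    using c(3)[unfolded l, of "Q + t *\<^sub>R u"] by (auto simp: inner_add_right)
  have cu: "c \<bullet> u = 0"
  proof (rule ccontr)
    assume "c \<bullet> u \<noteq> 0"
    then show False using ge[of "(b - 1 - c \<bullet> Q) / (c \<bullet> u)"] by simp
  qed
  have "c \<bullet> (x - Q) \<le> 0" if "x \<in> C" for x
    using c(2)[OF that] ge[of 0] by (simp add: inner_diff_right)
  then show False using support_transversal c(1) cu by blast
qed

text \<open>Transversality allows division of the normal \<open>a\<close> by
  \<open>a \<bullet> u\<close>. The sign of this number is still open, hence the disjunction; the
  opposite end of the chord settles it in the next two lemmas.\<close>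

lemma supporting_line_slanted:
  assumes "supporting_line C (Q + t *\<^sub>R u) p"
  obtains s where "p = slanted_line s (Q + t *\<^sub>R u)"
    "(\<forall>x\<in>C. (u + s *\<^sub>R perp u) \<bullet> (x - (Q + t *\<^sub>R u)) \<le> 0) \<or>
     (\<forall>x\<in>C. (u + s *\<^sub>R perp u) \<bullet> (x - (Q + t *\<^sub>R u)) \<ge> 0)"
proof -
  let ?P = "Q + t *\<^sub>R u"
  obtain a b where a: "a \<noteq> 0" "p = {x. a \<bullet> x = b}" "\<And>x. x \<in> C \<Longrightarrow> a \<bullet> x \<le> b" "a \<bullet> ?P = b"
    using assms by (auto simp: supporting_line_def)
  have au: "a \<bullet> u \<noteq> 0"
  proof
    assume au: "a \<bullet> u = 0"
    then have "a \<bullet> (x - Q) \<le> 0" if "x \<in> C" for x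
      using a(3)[OF that] a(4) by (simp add: inner_diff_right inner_add_right)
    then show False using support_transversal a(1) au by blast
  qed
  define s where "s = (a \<bullet> perp u) / (a \<bullet> u)"
  have "a = (a \<bullet> u) *\<^sub>R (u + s *\<^sub>R perp u)"
    using orthonormal_expansion[OF u, of a] au by (simp add: s_def scaleR_add_right)
  then have a_s: "a \<bullet> x - b = (a \<bullet> u) * ((u + s *\<^sub>R perp u) \<bullet> (x - ?P))" for x
    using a(4) by (metis inner_diff_right inner_scaleR_left)
  show thesis
  proof (rule that)
    show "p = slanted_line s ?P"
    proof -
      have "a \<bullet> x = b \<longleftrightarrow> (u + s *\<^sub>R perp u) \<bullet> (x - ?P) = 0" for x
        using a_s[of x] au by (metis eq_iff_diff_eq_0 mult_eq_0_iff)
      then show ?thesis unfolding a(2) slanted_line_def by blast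
    qed
    have le: "(a \<bullet> u) * ((u + s *\<^sub>R perp u) \<bullet> (x - ?P)) \<le> 0" if "x \<in> C" for x
      using a_s[of x] a(3)[OF that] by simp
    show "(\<forall>x\<in>C. (u + s *\<^sub>R perp u) \<bullet> (x - ?P) \<le> 0) \<or> (\<forall>x\<in>C. (u + s *\<^sub>R perp u) \<bullet> (x - ?P) \<ge> 0)"
    proof (cases "a \<bullet> u > 0")
      case True
      then show ?thesis using le by (force simp: mult_le_0_iff)
    next
      case False
      then show ?thesis using le au by (force simp: mult_le_0_iff)
    qed
  qed
qed

lemma supporting_line_far:
  assumes "supporting_line C (Q + \<alpha> *\<^sub>R u) p"
  obtains s where "p = slanted_line s (Q + \<alpha> *\<^sub>R u)"
    "\<And>x. x \<in> C \<Longrightarrow> (u + s *\<^sub>R perp u) \<bullet> (x - (Q + \<alpha> *\<^sub>R u)) \<le> 0"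
proof -
  obtain s where s: "p = slanted_line s (Q + \<alpha> *\<^sub>R u)"
    "(\<forall>x\<in>C. (u + s *\<^sub>R perp u) \<bullet> (x - (Q + \<alpha> *\<^sub>R u)) \<le> 0) \<or>
     (\<forall>x\<in>C. (u + s *\<^sub>R perp u) \<bullet> (x - (Q + \<alpha> *\<^sub>R u)) \<ge> 0)"
    using supporting_line_slanted[OF assms] by metis
  have "(u + s *\<^sub>R perp u) \<bullet> (Q + \<beta> *\<^sub>R u - (Q + \<alpha> *\<^sub>R u)) = \<beta> - \<alpha>"
    by (simp add: inner_diff_right inner_add_left)
  then show thesis using s that endpoints_in(2) nondegenerate by (metis diff_ge_0_iff_ge not_less)
qed

lemma supporting_line_near:
  assumes "supporting_line C (Q + \<beta> *\<^sub>R u) p"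
  obtains s where "p = slanted_line s (Q + \<beta> *\<^sub>R u)"
    "\<And>x. x \<in> C \<Longrightarrow> (u + s *\<^sub>R perp u) \<bullet> (x - (Q + \<beta> *\<^sub>R u)) \<ge> 0"
proof -
  obtain s where s: "p = slanted_line s (Q + \<beta> *\<^sub>R u)"
    "(\<forall>x\<in>C. (u + s *\<^sub>R perp u) \<bullet> (x - (Q + \<beta> *\<^sub>R u)) \<le> 0) \<or>
     (\<forall>x\<in>C. (u + s *\<^sub>R perp u) \<bullet> (x - (Q + \<beta> *\<^sub>R u)) \<ge> 0)"
    using supporting_line_slanted[OF assms] by metis
  have "(u + s *\<^sub>R perp u) \<bullet> (Q + \<alpha> *\<^sub>R u - (Q + \<beta> *\<^sub>R u)) = \<alpha> - \<beta>"
    by (simp add: inner_diff_right inner_add_left)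
  then show thesis using s that endpoints_in(1) nondegenerate by (metis diff_le_0_iff_le not_less)
qed

section \<open>First-order condition and uniqueness of the supporting lines\<close>

lemma supporting_line_exists:
  assumes "t = \<alpha> \<or> t = \<beta>"
  shows "\<exists>p. supporting_line C (Q + t *\<^sub>R u) p"
proof -
  let ?P = "Q + t *\<^sub>R u"
  have "{?P} \<inter> interior C = {}" using not_interior_endpoint[OF assms] by simp
  then obtain c b where c: "c \<noteq> 0" "\<And>x. x \<in> C \<Longrightarrow> c \<bullet> x \<le> b" "\<And>x. x \<in> {?P} \<Longrightarrow> b \<le> c \<bullet> x"
    using separate_from_interior[OF C, of "{?P}"] by auto
  have P: "?P \<in> C" using assms endpoints_in by auto
  have "supporting_line C ?P {x. c \<bullet> x = b}"
    using c(1,2) c(3)[of ?P] c(2)[OF P] P by (auto simp: supporting_line_def)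
  then show ?thesis by blast
qed

lemma stationary:
  assumes far: "\<And>x. x \<in> C \<Longrightarrow> (u + s *\<^sub>R perp u) \<bullet> (x - (Q + \<alpha> *\<^sub>R u)) \<le> 0"
    and near: "\<And>x. x \<in> C \<Longrightarrow> (u + t *\<^sub>R perp u) \<bullet> (x - (Q + \<beta> *\<^sub>R u)) \<ge> 0"
  shows "\<alpha> * s = \<beta> * t"
proof -
  \<comment> \<open>The length cut off by the two supporting lines on the ray at angle
    \<open>\<theta>\<close>; at 0 it is the chord length \<open>\<alpha> - \<beta>\<close>.\<close>
  define h where "h \<theta> = \<alpha> / (cos \<theta> + s * sin \<theta>) - \<beta> / (cos \<theta> + t * sin \<theta>)" for \<theta>
  have dir: "(u + r *\<^sub>R perp u) \<bullet> (Q + \<rho> *\<^sub>R turn \<theta> u - (Q + \<gamma> *\<^sub>R u))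
      = \<rho> * (cos \<theta> + r * sin \<theta>) - \<gamma>" for r \<rho> \<gamma> \<theta>
    by (simp add: turn_def inner_diff_right inner_add_left inner_add_right algebra_simps)
  have pos: "\<forall>\<^sub>F \<theta> in nhds 0. 0 < cos \<theta> + r * sin \<theta>" for r :: real
  proof -
    have "((\<lambda>\<theta>. cos \<theta> + r * sin \<theta>) \<longlongrightarrow> cos 0 + r * sin 0) (nhds 0)"
      by (intro tendsto_intros filterlim_ident)
    then show ?thesis by (rule order_tendstoD) simp
  qed
  have "\<forall>\<^sub>F \<theta> in nhds 0. h 0 \<le> h \<theta>"
    using nearby pos[of s] pos[of t]
  proof eventually_elim
    case (elim \<theta>)
    then obtain \<sigma> \<rho> where *: "Q + \<sigma> *\<^sub>R turn \<theta> u \<in> C" "Q + \<rho> *\<^sub>R turn \<theta> u \<in> C" "\<alpha> - \<beta> \<le> \<rho> - \<sigma>"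
      by blast
    have "\<rho> \<le> \<alpha> / (cos \<theta> + s * sin \<theta>)"
      using far[OF *(2)] elim(2) unfolding dir by (simp add: pos_le_divide_eq)
    moreover have "\<beta> / (cos \<theta> + t * sin \<theta>) \<le> \<sigma>"
      using near[OF *(1)] elim(3) unfolding dir by (simp add: pos_divide_le_eq)
    ultimately show ?case using *(3) by (simp add: h_def)
  qed
  then obtain d where "d > 0" "\<forall>y. \<bar>0 - y\<bar> < d \<longrightarrow> h 0 \<le> h y"
    by (auto simp: eventually_nhds_metric dist_norm)
  moreover have "(h has_real_derivative (- (\<alpha> * s) + \<beta> * t)) (at 0)"
    unfolding h_def by (rule derivative_eq_intros refl | simp)+
  ultimately have "- (\<alpha> * s) + \<beta> * t = 0" by (metis DERIV_local_min)
  then show ?thesis by simp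
qed

text \<open>One supporting line is fixed at each end. Pairing any other with the fixed line at the
  opposite end, \<open>stationary\<close> yields the same slope because \<open>\<alpha>\<close> and
  \<open>\<beta>\<close> are nonzero.\<close>

lemma unique_supporting_lines:
  obtains s t where "\<alpha> * s = \<beta> * t"
    "supporting_line C (Q + \<alpha> *\<^sub>R u) (slanted_line s (Q + \<alpha> *\<^sub>R u))"
    "\<And>p. supporting_line C (Q + \<alpha> *\<^sub>R u) p \<Longrightarrow> p = slanted_line s (Q + \<alpha> *\<^sub>R u)"
    "supporting_line C (Q + \<beta> *\<^sub>R u) (slanted_line t (Q + \<beta> *\<^sub>R u))"
    "\<And>p. supporting_line C (Q + \<beta> *\<^sub>R u) p \<Longrightarrow> p = slanted_line t (Q + \<beta> *\<^sub>R u)"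
proof -
  obtain p where p: "supporting_line C (Q + \<alpha> *\<^sub>R u) p" using supporting_line_exists by blast
  obtain q where q: "supporting_line C (Q + \<beta> *\<^sub>R u) q" using supporting_line_exists by blast
  obtain s where s: "p = slanted_line s (Q + \<alpha> *\<^sub>R u)"
    "\<And>x. x \<in> C \<Longrightarrow> (u + s *\<^sub>R perp u) \<bullet> (x - (Q + \<alpha> *\<^sub>R u)) \<le> 0"
    using supporting_line_far[OF p] by metis
  obtain t where t: "q = slanted_line t (Q + \<beta> *\<^sub>R u)"
    "\<And>x. x \<in> C \<Longrightarrow> (u + t *\<^sub>R perp u) \<bullet> (x - (Q + \<beta> *\<^sub>R u)) \<ge> 0"
    using supporting_line_near[OF q] by metis
  have st: "\<alpha> * s = \<beta> * t" by (rule stationary[OF s(2) t(2)])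
  show thesis
  proof (rule that[OF st])
    fix p' assume "supporting_line C (Q + \<alpha> *\<^sub>R u) p'"
    then obtain s' where s': "p' = slanted_line s' (Q + \<alpha> *\<^sub>R u)"
      "\<And>x. x \<in> C \<Longrightarrow> (u + s' *\<^sub>R perp u) \<bullet> (x - (Q + \<alpha> *\<^sub>R u)) \<le> 0"
      using supporting_line_far by metis
    have "\<alpha> * s' = \<alpha> * s" using stationary[OF s'(2) t(2)] st by simp
    then show "p' = slanted_line s (Q + \<alpha> *\<^sub>R u)" using s' \<beta> \<beta>\<alpha> by simp
  next
    fix q' assume "supporting_line C (Q + \<beta> *\<^sub>R u) q'"
    then obtain t' where t': "q' = slanted_line t' (Q + \<beta> *\<^sub>R u)"
      "\<And>x. x \<in> C \<Longrightarrow> (u + t' *\<^sub>R perp u) \<bullet> (x - (Q + \<beta> *\<^sub>R u)) \<ge> 0"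
      using supporting_line_near by metis
    have "\<beta> * t' = \<beta> * t" using stationary[OF s(2) t'(2)] st by (rule trans[OF sym])
    then show "q' = slanted_line t (Q + \<beta> *\<^sub>R u)" using t'(1) \<beta> by auto
  qed (use p q s t in auto)
qed

lemma CPP_slanted_lines:
  assumes "\<alpha> * s = \<beta> * t"
  shows "CPP (slanted_line s (Q + \<alpha> *\<^sub>R u)) (slanted_line t (Q + \<beta> *\<^sub>R u))
    (range (\<lambda>t. Q + t *\<^sub>R u)) (Q + \<alpha> *\<^sub>R u) (Q + \<beta> *\<^sub>R u) Q"
proof -
  have line: "is_line (slanted_line r P)" for r P
  proof -
    have "(u + r *\<^sub>R perp u) \<bullet> u = 1" by (simp add: inner_add_left)
    then have "u + r *\<^sub>R perp u \<noteq> 0" by auto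
    moreover have "slanted_line r P = {x. (u + r *\<^sub>R perp u) \<bullet> x = (u + r *\<^sub>R perp u) \<bullet> P}"
      by (simp add: slanted_line_def inner_diff_right)
    ultimately show ?thesis by (simp add: is_line_hyperplane)
  qed
  have "perp u \<noteq> 0" using inner_u(2) by fastforce
  then have "is_line (range (\<lambda>t. Q + t *\<^sub>R u))"
    by (simp add: line_eq_hyperplane[OF u] is_line_hyperplane)
  moreover have "Q \<in> range (\<lambda>t. Q + t *\<^sub>R u)" by (rule range_eqI[of _ _ 0]) simp
  moreover have perp: "Q - (\<gamma> * r) *\<^sub>R perp u
      \<in> perpendicular_at (slanted_line r (Q + \<gamma> *\<^sub>R u)) (Q + \<gamma> *\<^sub>R u)" for \<gamma> r
  proof -
    \<comment> \<open>The vector from the chord end to the candidate point is a multiple of the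
      normal of the slanted line.\<close>
    have "Q - (\<gamma> * r) *\<^sub>R perp u - (Q + \<gamma> *\<^sub>R u) = (- \<gamma>) *\<^sub>R (u + r *\<^sub>R perp u)"
      by (simp add: algebra_simps)
    moreover have "(u + r *\<^sub>R perp u) \<bullet> (y - z) = 0"
      if "y \<in> slanted_line r P" "z \<in> slanted_line r P" for y z P
      using that by (simp add: slanted_line_def inner_diff_right)
    ultimately show ?thesis unfolding perpendicular_at_def by (simp del: scaleR_minus_left)
  qed
  moreover have "Q - (\<alpha> * s) *\<^sub>R perp u \<in> perpendicular_at (range (\<lambda>t. Q + t *\<^sub>R u)) Q"
    by (auto simp: perpendicular_at_def inner_diff_right inner_add_right)
  ultimately show ?thesis
    unfolding CPP_def using line perp[of \<alpha> s] perp[of \<beta> t] assms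
    by (auto simp: slanted_line_def)
qed

end

section \<open>From the rotating line to the minimal chord\<close>

lemma closed_segment_on_line:
  fixes u :: point
  shows "closed_segment (Q + a *\<^sub>R u) (Q + b *\<^sub>R u) = (\<lambda>t. Q + t *\<^sub>R u) ` closed_segment a b"
proof -
  have "(1 - r) *\<^sub>R (Q + a *\<^sub>R u) + r *\<^sub>R (Q + b *\<^sub>R u) = Q + ((1 - r) * a + r * b) *\<^sub>R u" for r
    by (simp add: algebra_simps)
  then show ?thesis by (auto simp: closed_segment_def image_def)
qed

theorem proposition16:
  fixes C l\<^sub>0 :: "(real^2) set" and Q A B :: "real^2" and \<phi>' :: real
  assumes "closed C" and "convex C" and "interior C \<noteq> {}" and "Q \<notin> C"
    and "is_line l\<^sub>0" and "Q \<in> l\<^sub>0"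
    and "\<phi>' \<in> interior (chord_domain Q l\<^sub>0 C)"
    and "\<forall>\<^sub>F \<phi> in at \<phi>' within chord_domain Q l\<^sub>0 C.
           chord_length Q l\<^sub>0 C \<phi>' \<le> chord_length Q l\<^sub>0 C \<phi>"
    and "rotated_line Q l\<^sub>0 \<phi>' \<inter> C = closed_segment A B"
    and "B \<in> closed_segment Q A"
  shows "\<exists>t\<^sub>1 t\<^sub>2.
      supporting_line C A t\<^sub>1 \<and> (\<forall>p. supporting_line C A p \<longrightarrow> p = t\<^sub>1) \<and>
      supporting_line C B t\<^sub>2 \<and> (\<forall>p. supporting_line C B p \<longrightarrow> p = t\<^sub>2) \<and>
      tangent_line (frontier C) A t\<^sub>1 \<and>
      tangent_line (frontier C) B t\<^sub>2 \<and>
      CPP t\<^sub>1 t\<^sub>2 (rotated_line Q l\<^sub>0 \<phi>') A B Q"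
proof -
  have AB: "A \<in> rotated_line Q l\<^sub>0 \<phi>'" "A \<in> C" "B \<in> C" using assms(9) by auto
  obtain v where v: "norm v = 1" "l\<^sub>0 = range (\<lambda>t. Q + t *\<^sub>R v)"
    using is_lineE[OF assms(5,6)] .
  obtain \<gamma> where \<gamma>: "A = Q + \<gamma> *\<^sub>R turn \<phi>' v"
    using AB(1) by (auto simp: v(2) rotated_line_range)
  have "\<gamma> \<noteq> 0" using \<gamma> AB assms(4) by auto
  \<comment> \<open>Reversing the direction if necessary puts \<open>A\<close> at a positive
    parameter without changing the line.\<close>
  define w where "w = sgn \<gamma> *\<^sub>R v"
  have w: "norm w = 1" using v \<open>\<gamma> \<noteq> 0\<close> by (simp add: w_def sgn_if)
  have l0: "l\<^sub>0 = range (\<lambda>t. Q + t *\<^sub>R w)"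
  proof -
    have "range (\<lambda>t. Q + t *\<^sub>R w) = (\<lambda>t. Q + t *\<^sub>R v) ` range (\<lambda>t. t * sgn \<gamma>)"
      by (simp add: w_def image_image)
    moreover have "range (\<lambda>t. t * sgn \<gamma>) = UNIV"
      using \<open>\<gamma> \<noteq> 0\<close> by (intro surjI[of _ "\<lambda>t. t * sgn \<gamma>"]) (auto simp: sgn_if)
    ultimately show ?thesis using v(2) by simp
  qed
  define u where "u = turn \<phi>' w"
  define \<alpha> where "\<alpha> = \<bar>\<gamma>\<bar>"
  have u: "norm u = 1" using w by (simp add: u_def)
  have line: "rotated_line Q l\<^sub>0 (\<phi>' + \<theta>) = range (\<lambda>t. Q + t *\<^sub>R turn \<theta> u)" for \<theta>
    by (simp add: l0 rotated_line_range u_def turn_turn add.commute)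
  have line0: "rotated_line Q l\<^sub>0 \<phi>' = range (\<lambda>t. Q + t *\<^sub>R u)"
    by (simp add: l0 rotated_line_range u_def)
  have A: "A = Q + \<alpha> *\<^sub>R u"
    using \<gamma> by (simp add: \<alpha>_def u_def w_def turn_scaleR abs_sgn mult.commute)
  have \<alpha>: "\<alpha> > 0" using \<open>\<gamma> \<noteq> 0\<close> by (simp add: \<alpha>_def)
  obtain \<tau> where \<tau>: "0 \<le> \<tau>" "\<tau> \<le> 1" "B = (1 - \<tau>) *\<^sub>R Q + \<tau> *\<^sub>R A"
    using assms(10) by (auto simp: in_segment)
  define \<beta> where "\<beta> = \<tau> * \<alpha>"
  have B: "B = Q + \<beta> *\<^sub>R u" by (simp add: \<tau>(3) A \<beta>_def algebra_simps)
  have "\<beta> \<noteq> 0" using B AB assms(4) by auto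
  then have \<beta>: "0 < \<beta>" "\<beta> \<le> \<alpha>" using \<tau> \<alpha> by (auto simp: \<beta>_def zero_less_mult_iff mult_left_le_one_le)
  have inj: "inj (\<lambda>t. Q + t *\<^sub>R u)" using u by (auto simp: inj_def)
  have seg: "range (\<lambda>t. Q + t *\<^sub>R u) \<inter> C = (\<lambda>t. Q + t *\<^sub>R u) ` {\<beta>..\<alpha>}"
    using assms(9) \<beta> by (simp add: line0 A B closed_segment_on_line closed_segment_eq_real_ivl)
  have chord: "Q + t *\<^sub>R u \<in> C \<longleftrightarrow> \<beta> \<le> t \<and> t \<le> \<alpha>" for t
  proof -
    have "Q + t *\<^sub>R u \<in> C \<longleftrightarrow> Q + t *\<^sub>R u \<in> range (\<lambda>t. Q + t *\<^sub>R u) \<inter> C" by auto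
    also have "\<dots> \<longleftrightarrow> t \<in> {\<beta>..\<alpha>}" unfolding seg by (rule inj_image_mem_iff[OF inj])
    finally show ?thesis by simp
  qed
  have "chord_endpoints Q l\<^sub>0 C \<phi>' A B"
    using assms(9,10) by (simp add: chord_endpoints_def)
  then have len0: "chord_length Q l\<^sub>0 C \<phi>' = \<alpha> - \<beta>"
    using \<beta> u by (simp add: chord_length_eq A B dist_norm flip: scaleR_diff_left)
  \<comment> \<open>Strict separation of \<open>Q\<close> from \<open>C\<close> fixes the side:
    points of \<open>C\<close> on a line through \<open>Q\<close> with direction \<open>d\<close>
    have parameters of the same sign as \<open>c \<bullet> d\<close>. By continuity this sign is
    positive for all directions near \<open>u\<close>.\<close>
  obtain c b where c: "c \<bullet> Q < b" "\<forall>x\<in>C. b < c \<bullet> x"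
    using separating_hyperplane_closed_point[OF assms(2,1,4)] by blast
  have cpos: "0 < r * (c \<bullet> d)" if "Q + r *\<^sub>R d \<in> C" for r d
    using c(1) bspec[OF c(2) that] by (simp add: inner_add_right)
  have cu: "0 < c \<bullet> u" using cpos[of \<alpha> u] AB(2) A \<alpha> by (simp add: zero_less_mult_iff)
  have ev_c: "\<forall>\<^sub>F \<theta> in nhds 0. 0 < c \<bullet> turn \<theta> u"
  proof -
    have "((\<lambda>\<theta>. c \<bullet> turn \<theta> u) \<longlongrightarrow> c \<bullet> turn 0 u) (nhds 0)"
      unfolding turn_def by (intro tendsto_intros filterlim_ident)
    then show ?thesis by (rule order_tendstoD) (use cu in \<open>simp add: turn_def\<close>)
  qed
  \<comment> \<open>As \<open>\<phi>'\<close> is interior to the domain, the minimum relative to the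
    domain holds on a full neighbourhood; at \<open>\<phi>'\<close> itself it is
    \<open>len0\<close>.\<close>
  have ev_min: "\<forall>\<^sub>F \<phi> in nhds \<phi>'. \<phi> \<in> chord_domain Q l\<^sub>0 C \<and> \<alpha> - \<beta> \<le> chord_length Q l\<^sub>0 C \<phi>"
  proof -
    have "\<forall>\<^sub>F \<phi> in nhds \<phi>'. \<phi> \<in> interior (chord_domain Q l\<^sub>0 C)"
      using assms(7) by (intro eventually_nhds_in_open) auto
    then show ?thesis
      using assms(8)[unfolded eventually_at_filter]
      by eventually_elim (use len0 interior_subset in auto)
  qed
  have ev_shift: "\<forall>\<^sub>F \<theta> in nhds 0. \<phi>' + \<theta> \<in> chord_domain Q l\<^sub>0 C \<and>
      \<alpha> - \<beta> \<le> chord_length Q l\<^sub>0 C (\<phi>' + \<theta>)"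
  proof -
    have "((\<lambda>\<theta>. \<phi>' + \<theta>) \<longlongrightarrow> \<phi>' + 0) (nhds 0)" by (intro tendsto_intros filterlim_ident)
    then show ?thesis using ev_min unfolding filterlim_iff by simp blast
  qed
  have nearby: "\<forall>\<^sub>F \<theta> in nhds 0. \<exists>\<sigma> \<rho>. 0 < \<sigma> \<and> Q + \<sigma> *\<^sub>R turn \<theta> u \<in> C \<and>
      Q + \<rho> *\<^sub>R turn \<theta> u \<in> C \<and> \<alpha> - \<beta> \<le> \<rho> - \<sigma>"
    using ev_c ev_shift
  proof eventually_elim
    case (elim \<theta>)
    let ?v = "turn \<theta> u"
    obtain X Y where XY: "rotated_line Q l\<^sub>0 (\<phi>' + \<theta>) \<inter> C = closed_segment X Y"
      using elim by (auto simp: chord_domain_def)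
    then have XYin: "X \<in> C" "Y \<in> C" "X \<in> range (\<lambda>t. Q + t *\<^sub>R ?v)" "Y \<in> range (\<lambda>t. Q + t *\<^sub>R ?v)"
      using line by auto
    then obtain x y where xy: "X = Q + x *\<^sub>R ?v" "Y = Q + y *\<^sub>R ?v" by blast
    \<comment> \<open>Sorting the parameters makes the segment \<open>closed_segment X Y\<close>
      satisfy the labelling required by \<open>chord_endpoints\<close>.\<close>
    define \<sigma> \<rho> where "\<sigma> = min x y" and "\<rho> = max x y"
    have mem: "Q + \<sigma> *\<^sub>R ?v \<in> C" "Q + \<rho> *\<^sub>R ?v \<in> C"
      using XYin xy by (auto simp: \<sigma>_def \<rho>_def min_def max_def)
    have \<sigma>: "0 < \<sigma>" "\<sigma> \<le> \<rho>"
      using cpos[OF mem(1)] elim by (auto simp: zero_less_mult_iff \<sigma>_def \<rho>_def)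
    have "closed_segment X Y = closed_segment (Q + \<rho> *\<^sub>R ?v) (Q + \<sigma> *\<^sub>R ?v)"
      by (auto simp: xy \<sigma>_def \<rho>_def min_def max_def closed_segment_commute)
    moreover have "Q + \<sigma> *\<^sub>R ?v \<in> closed_segment Q (Q + \<rho> *\<^sub>R ?v)"
      using closed_segment_on_line[of Q 0 ?v \<rho>] \<sigma> by (auto simp: closed_segment_eq_real_ivl)
    ultimately have "chord_endpoints Q l\<^sub>0 C (\<phi>' + \<theta>) (Q + \<rho> *\<^sub>R ?v) (Q + \<sigma> *\<^sub>R ?v)"
      using XY by (simp add: chord_endpoints_def)
    then have "chord_length Q l\<^sub>0 C (\<phi>' + \<theta>) = \<rho> - \<sigma>"
      using \<sigma> u by (simp add: chord_length_eq dist_norm flip: scaleR_diff_left)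
    then show ?case using elim mem \<sigma> by auto
  qed
  interpret minimal_chord C Q u \<alpha> \<beta>
    using assms(1-3) u \<beta> chord nearby by unfold_locales
  obtain s t where st: "\<alpha> * s = \<beta> * t"
    "supporting_line C A (slanted_line s A)"
    "\<And>p. supporting_line C A p \<Longrightarrow> p = slanted_line s A"
    "supporting_line C B (slanted_line t B)"
    "\<And>p. supporting_line C B p \<Longrightarrow> p = slanted_line t B"
    using unique_supporting_lines unfolding A B by blast
  moreover have "tangent_line (frontier C) A (slanted_line s A)"
    by (rule unique_support_tangent[OF C st(2,3)])
  moreover have "tangent_line (frontier C) B (slanted_line t B)"
    by (rule unique_support_tangent[OF C st(4,5)])
  moreover have "CPP (slanted_line s A) (slanted_line t B) (rotated_line Q l\<^sub>0 \<phi>') A B Q"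
    using CPP_slanted_lines[OF st(1)] by (simp add: A B line0)
  ultimately show ?thesis by blast
qed

end
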